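(* Let $E$ be a finite list of linearly independent vectors in $\mathbb{Z}^n$, and let $\mathcal{M}=(E,r,m)$ with $r(A)=\operatorname{rank}\langle A\rangle$ and $m(A)=|(\mathbb{Z}^n/\langle A\rangle)_{\mathrm{tor}}|$ for $A\subseteq E$. For a family $\underline k=(k_e)_{e\in E}$ of positive integers and $A\subseteq E$, let $\underline k\cdot A=\{k_ee:e\in A\}$ and let $\mathcal{Z}(\underline k\cdot A)^\diamond=\{\sum_{e\in A}\lambda_ek_ee: 0\le\lambda_e<1\}$ be the half-open zonotope. For $p_e\in[0,1]$, $$\mathbb{E}\bigl[|\mathcal{Z}(\underline k\cdot E_{\underline p})^\diamond\cap\mathbb{Z}^n|\bigr]=\prod_{e\in E}(1-p_e)\;\mathbf{Z}_{\mathcal{M}}\Bigl(1,\bigl(\tfrac{k_ep_e}{1-p_e}\bigr)_{e\in E}\Bigr).$$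
   Context: $\langle A\rangle$ is the subgroup of $\mathbb{Z}^n$ generated by $A$ and $(\cdot)_{\mathrm{tor}}$ the torsion subgroup. $\mathbf{Z}_{\mathcal{M}}(q,(v_e))=\sum_{A\subseteq E}m(A)q^{-r(A)}\prod_{e\in A}v_e$. $E_{\underline p}$ is the random sublist containing each $e$ independently with probability $p_e$. The right-hand side is understood as the polynomial $\sum_{A\subseteq E}m(A)\prod_{e\in A}k_ep_e\prod_{e\in E\setminus A}(1-p_e)$. *)

theory Defs
  imports
    "HOL-Probability.Probability"
    "HOL-Probability.Product_PMF"
    "HOL-Algebra.Generated_Groups"
begin

text \<open>
  A list \<open>E\<close> of vectors is indexed by \<open>{..<length E}\<close>, and its sublists are represented by
  subsets of this index set; families \<open>(x\<^sub>e)\<close> indexed by the members of \<open>E\<close> are functions on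
  indices.
\<close>

definition int_vec_group :: "(int ^ 'n) monoid" where
  "int_vec_group = \<lparr>carrier = UNIV, monoid.mult = (+), one = 0\<rparr>"

lemma comm_group_int_vec_group: "comm_group (int_vec_group :: (int ^ 'n) monoid)"
proof (rule comm_groupI)
  fix x :: "int ^ 'n"
  show "\<exists>y\<in>carrier int_vec_group. y \<otimes>\<^bsub>int_vec_group\<^esub> x = \<one>\<^bsub>int_vec_group\<^esub>"
    by (auto simp: int_vec_group_def intro: exI[of _ "- x"])
qed (auto simp: int_vec_group_def algebra_simps)

lemma module_int_vec: "Modules.module ((*s) :: int \<Rightarrow> int ^ 'n \<Rightarrow> int ^ 'n)"
  by unfold_locales (auto simp: vec_eq_iff algebra_simps)

abbreviation int_independent :: "(int ^ 'n) set \<Rightarrow> bool" where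
  "int_independent B \<equiv> \<not> Modules.module.dependent (*s) B"

text \<open>
  Independence is taken over the integers, which for integer vectors is the same as over the
  rationals or the reals.  A linearly independent list has no repetitions.
\<close>

definition lin_independent_list :: "(int ^ 'n) list \<Rightarrow> bool" where
  "lin_independent_list E \<longleftrightarrow> distinct E \<and> int_independent (set E)"

definition subgroup_rank :: "(int ^ 'n) set \<Rightarrow> nat" where
  "subgroup_rank H = Max {card B | B. finite B \<and> B \<subseteq> H \<and> int_independent B}"

definition torsion :: "('a, 'b) monoid_scheme \<Rightarrow> 'a set" where
  "torsion G = {x \<in> carrier G. \<exists>n::nat. n > 0 \<and> x [^]\<^bsub>G\<^esub> n = \<one>\<^bsub>G\<^esub>}"

definition sublist_span :: "(int ^ 'n) list \<Rightarrow> nat set \<Rightarrow> (int ^ 'n) set" where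
  "sublist_span E A = generate int_vec_group ((!) E ` A)"

definition sublist_rank :: "(int ^ 'n) list \<Rightarrow> nat set \<Rightarrow> nat" where
  "sublist_rank E A = subgroup_rank (sublist_span E A)"

definition sublist_mult :: "(int ^ 'n) list \<Rightarrow> nat set \<Rightarrow> nat" where
  "sublist_mult E A = card (torsion (int_vec_group Mod sublist_span E A))"

definition arith_matroid ::
  "(int ^ 'n) list \<Rightarrow> nat set \<times> (nat set \<Rightarrow> nat) \<times> (nat set \<Rightarrow> nat)" where
  "arith_matroid E = ({..<length E}, sublist_rank E, sublist_mult E)"

definition multivariate_tutte ::
  "'a set \<times> ('a set \<Rightarrow> nat) \<times> ('a set \<Rightarrow> nat) \<Rightarrow> real \<Rightarrow> ('a \<Rightarrow> real) \<Rightarrow> real" where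
  "multivariate_tutte M q v = (case M of (S, r, m) \<Rightarrow>
     (\<Sum>A\<in>Pow S. real (m A) * q powi (- int (r A)) * (\<Prod>e\<in>A. v e)))"

definition real_vec :: "int ^ 'n \<Rightarrow> real ^ 'n" where
  "real_vec x = (\<chi> j. real_of_int (x $ j))"

definition half_open_zonotope :: "nat set \<Rightarrow> (nat \<Rightarrow> int ^ 'n) \<Rightarrow> (real ^ 'n) set" where
  "half_open_zonotope A w =
     {(\<Sum>i\<in>A. l i *\<^sub>R real_vec (w i)) | l. \<forall>i\<in>A. 0 \<le> l i \<and> l i < 1}"

definition integer_points :: "(real ^ 'n) set" where
  "integer_points = range real_vec"

definition random_sublist :: "(int ^ 'n) list \<Rightarrow> (nat \<Rightarrow> real) \<Rightarrow> nat set pmf" where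
  "random_sublist E p =
     map_pmf (\<lambda>f. {i. f i}) (Pi_pmf {..<length E} False (\<lambda>i. bernoulli_pmf (p i)))"

end

theory Submission
  imports Defs
begin

text \<open>
  It suffices to show that the half-open zonotope of \<open>k \<cdot> A\<close> contains
  \<open>m(A) \<Prod> k\<^sub>e\<close> integer points and to sum over \<open>A\<close>.  Coordinates with respect to \<open>A\<close> are
  unique, so splitting them into integer and fractional parts tiles this zonotope by
  \<open>\<Prod> k\<^sub>e\<close> lattice translates of the half-open zonotope of \<open>A\<close>, and makes the integer points
  of the latter a system of representatives for the integer points of the real span of \<open>A\<close> modulo
  \<open>\<langle>A\<rangle>\<close>.  An integer vector in the real span of \<open>A\<close> lies in its rational span, so these classes
  form the torsion subgroup of \<open>\<int>\<^sup>n/\<langle>A\<rangle>\<close>.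
\<close>

section \<open>From real relations to integer relations\<close>

text \<open>View the reals as a vector space over the rationals: a nonzero \<open>r\<close> is
  independent there, so the value 1 at \<open>r\<close> extends to a linear map into the
  rationals.\<close>

lemma additive_functional_exists:
  fixes r :: real
  assumes "r \<noteq> 0"
  obtains f :: "real \<Rightarrow> rat" where "\<And>x y. f (x + y) = f x + f y" "f r = 1"
proof -
  interpret A: vector_space "\<lambda>q x. of_rat q * x :: real"
    by unfold_locales (auto simp: algebra_simps of_rat_add of_rat_mult)
  interpret B: vector_space "(*) :: rat \<Rightarrow> rat \<Rightarrow> rat"
    by unfold_locales (auto simp: algebra_simps)
  interpret AB: vector_space_pair "\<lambda>q x. of_rat q * x :: real" "(*) :: rat \<Rightarrow> rat \<Rightarrow> rat" ..
  have "A.independent {r}" using assms by simp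
  from AB.linear_independent_extend[OF this, of "\<lambda>_. 1"] obtain g
    where g: "Vector_Spaces.linear (\<lambda>q x. of_rat q * x :: real) (*) g" "g r = 1" by auto
  show ?thesis using that[of g] g AB.linear_add[OF g(1)] by blast
qed

lemma additive_of_int_mult:
  fixes f :: "real \<Rightarrow> rat"
  assumes add: "\<And>x y. f (x + y) = f x + f y"
  shows "f (x * of_int z) = f x * of_int z"
proof -
  have 0: "f 0 = 0" using add[of 0 0] by simp
  have minus: "f (- x) = - f x" for x using add[of x "- x"] 0 by (simp add: eq_neg_iff_add_eq_0 add.commute)
  have nat: "f (x * of_nat n) = f x * of_nat n" for n
    by (induction n) (auto simp: 0 add algebra_simps)
  show ?thesis
  proof (cases z)
    case (nonneg n) then show ?thesis using nat[of n] by simp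
  next
    case (neg n) then show ?thesis using nat[of "Suc n"] minus[of "x * of_nat (Suc n)"]
      by (simp del: of_nat_Suc)
  qed
qed

lemma common_denominator:
  fixes f :: "'a \<Rightarrow> rat"
  assumes "finite A"
  obtains N :: int and c :: "'a \<Rightarrow> int"
  where "N > 0" "\<And>i. i \<in> A \<Longrightarrow> of_int N * f i = of_int (c i)"
proof -
  define d where "d i = snd (quotient_of (f i))" for i
  define n where "n i = fst (quotient_of (f i))" for i
  have d: "d i > 0" for i unfolding d_def by (rule quotient_of_denom_pos')
  have fi: "f i * of_int (d i) = of_int (n i)" for i
    using d[of i] quotient_of_div[of "f i" "n i" "d i"]
    by (simp add: d_def n_def nonzero_eq_divide_eq)
  \<comment> \<open>The common denominator is the product of all denominators; taking out the factor
    \<open>d i\<close> leaves an integer multiple of the numerator of \<open>f i\<close>.\<close>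
  have "of_int (prod d A) * f i = of_int (prod d (A - {i}) * n i)" if "i \<in> A" for i
    using prod.remove[OF assms that, of d] fi[of i] by (simp add: algebra_simps)
  moreover have "prod d A > 0" using d by (simp add: prod_pos)
  ultimately show ?thesis by (rule that[rotated])
qed

text \<open>An additive functional from the reals to the rationals, normalised at one nonzero
  coefficient, turns a real relation between integer vectors into a rational one.\<close>

lemma real_relation_imp_int_relation:
  fixes w :: "'a \<Rightarrow> int ^ 'n" and l :: "'a \<Rightarrow> real"
  assumes fin: "finite A" and rel: "(\<Sum>i\<in>A. l i *\<^sub>R real_vec (w i)) = 0"
    and b: "b \<in> A" "l b \<noteq> 0"
  obtains c :: "'a \<Rightarrow> int" where "c b > 0" "(\<Sum>i\<in>A. c i *s w i) = 0"
proof -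
  obtain f :: "real \<Rightarrow> rat" where add: "\<And>x y. f (x + y) = f x + f y" and fb: "f (l b) = 1"
    using additive_functional_exists[OF b(2)] by blast
  have f0: "f 0 = 0" using add[of 0 0] by simp
  have fsum: "f (\<Sum>i\<in>A. g i) = (\<Sum>i\<in>A. f (g i))" for g
    using fin by (induction A rule: finite_induct) (auto simp: f0 add)
  obtain N c where N: "N > 0" and c: "\<And>i. i \<in> A \<Longrightarrow> of_int N * f (l i) = of_int (c i)"
    using common_denominator[OF fin, of "\<lambda>i. f (l i)"] by blast
  \<comment> \<open>The normalisation \<open>f (l b) = 1\<close> makes the coefficient at
    \<open>b\<close> equal to the common denominator, hence positive.\<close>
  have "c b = N" using c[OF b(1)] fb by simp
  moreover have "(\<Sum>i\<in>A. c i * w i $ j) = 0" for j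
  proof -
    have "(\<Sum>i\<in>A. l i * of_int (w i $ j)) = 0"
      using arg_cong[OF rel, of "\<lambda>v. v $ j"] by (simp add: real_vec_def)
    \<comment> \<open>The entries \<open>w i $ j\<close> are integers, so the merely additive
      \<open>f\<close> can be applied to the coefficients alone.\<close>
    then have "(\<Sum>i\<in>A. f (l i) * of_int (w i $ j)) = 0"
      using fsum[of "\<lambda>i. l i * of_int (w i $ j)"] by (simp add: additive_of_int_mult[OF add] f0)
    then have "0 = of_int N * (\<Sum>i\<in>A. f (l i) * of_int (w i $ j))" by simp
    also have "\<dots> = (\<Sum>i\<in>A. of_int (c i * w i $ j))"
      by (auto simp: sum_distrib_left c mult.assoc[symmetric] intro!: sum.cong)
    finally have "of_int (\<Sum>i\<in>A. c i * w i $ j) = (0::rat)" by simp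
    then show ?thesis by (simp only: of_int_eq_0_iff)
  qed
  ultimately show ?thesis using that[of c] N by (simp add: vec_eq_iff)
qed

section \<open>Embedding of integer vectors, and independence by position\<close>

lemma real_vec_eq_iff [simp]: "real_vec x = real_vec y \<longleftrightarrow> x = y"
  by (simp add: real_vec_def vec_eq_iff)

lemma real_vec_add: "real_vec (x + y) = real_vec x + real_vec y"
  by (simp add: real_vec_def vec_eq_iff)

lemma real_vec_smult: "real_vec (c *s x) = of_int c *\<^sub>R real_vec x"
  by (simp add: real_vec_def vec_eq_iff)

lemma real_vec_sum: "real_vec (\<Sum>i\<in>A. f i) = (\<Sum>i\<in>A. real_vec (f i))"
  by (simp add: real_vec_def vec_eq_iff)

text \<open>Independence is defined for a set of vectors. Distinctness makes \<open>(!) E\<close>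
  injective on the indices, so coefficients given by position can be moved to the vectors
  themselves.\<close>

lemma lin_independent_list_relation:
  assumes "lin_independent_list E" "A \<subseteq> {..<length E}"
    and rel: "(\<Sum>i\<in>A. c i *s E ! i) = 0" and "i \<in> A"
  shows "c i = 0"
proof -
  have inj: "inj_on ((!) E) A"
    using assms(1,2) by (auto simp: lin_independent_list_def intro: inj_on_nth)
  have fin: "finite A" using assms(2) finite_subset by blast
  have "(\<Sum>v\<in>(!) E ` A. c (inv_into A ((!) E) v) *s v) = 0"
    using rel by (simp add: sum.reindex[OF inj] inv_into_f_f[OF inj])
  moreover have "(!) E ` A \<subseteq> set E" using assms(2) by auto
  ultimately have "\<forall>v\<in>(!) E ` A. c (inv_into A ((!) E) v) = 0"
    using assms(1) fin unfolding lin_independent_list_def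
    by (intro ballI Modules.module.independentD[OF module_int_vec, of "set E" "(!) E ` A"]) auto
  then show ?thesis using inv_into_f_f[OF inj assms(4)] assms(4) by force
qed

section \<open>Real span and torsion for one independent family\<close>

locale int_independent_family =
  fixes A :: "nat set" and w :: "nat \<Rightarrow> int ^ 'n"
  assumes finite_A [simp]: "finite A"
    and int_relation: "\<And>c i. (\<Sum>i\<in>A. c i *s w i) = 0 \<Longrightarrow> i \<in> A \<Longrightarrow> c i = 0"
begin

text \<open>Two expansions that differ at \<open>i\<close> give a real relation with nonzero
  coefficient at \<open>i\<close>, hence an integer relation with positive coefficient there,
  against \<open>int_relation\<close>.\<close>

lemma real_coefficients_unique:
  assumes "(\<Sum>i\<in>A. l i *\<^sub>R real_vec (w i)) = (\<Sum>i\<in>A. l' i *\<^sub>R real_vec (w i))" "i \<in> A"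
  shows "l i = l' i"
proof (rule ccontr)
  assume "l i \<noteq> l' i"
  moreover have "(\<Sum>i\<in>A. (l i - l' i) *\<^sub>R real_vec (w i)) = 0"
    using assms(1) by (simp add: scaleR_left_diff_distrib sum_subtractf)
  ultimately obtain c where "c i > 0" "(\<Sum>i\<in>A. c i *s w i) = 0"
    using real_relation_imp_int_relation[of A "\<lambda>i. l i - l' i" w i] assms(2) by auto
  then show False using int_relation[of c i] assms(2) by simp
qed

definition lattice :: "(int ^ 'n) set" where
  "lattice = {\<Sum>i\<in>A. c i *s w i | c. True}"

lemma sum_in_lattice: "(\<Sum>i\<in>A. c i *s w i) \<in> lattice"
  unfolding lattice_def by (rule CollectI) (rule exI[of _ c], simp)

text \<open>Adjoin \<open>x\<close> to the family at a fresh index \<open>b\<close> with coefficient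
  -1. The expansion of \<open>x\<close> becomes a real relation; an integer relation with positive
  coefficient at \<open>b\<close> then puts that multiple of \<open>x\<close> into the
  lattice.\<close>

lemma real_span_imp_torsion:
  assumes "real_vec x = (\<Sum>i\<in>A. l i *\<^sub>R real_vec (w i))"
  obtains N :: nat where "N > 0" "int N *s x \<in> lattice"
proof -
  obtain b where b: "b \<notin> A" using ex_new_if_finite[OF infinite_UNIV_nat finite_A] by blast
  define l' where "l' = l(b := -1)"
  define w' where "w' = w(b := x)"
  have "(\<Sum>i\<in>A. l' i *\<^sub>R real_vec (w' i)) = real_vec x"
    unfolding assms by (rule sum.cong) (use b in \<open>auto simp: l'_def w'_def\<close>)
  then have "(\<Sum>i\<in>insert b A. l' i *\<^sub>R real_vec (w' i)) = 0"
    using b by (simp add: l'_def w'_def)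
  then obtain c where c: "c b > 0" "(\<Sum>i\<in>insert b A. c i *s w' i) = 0"
    using real_relation_imp_int_relation[of "insert b A" l' w' b] by (auto simp: l'_def)
  have "(\<Sum>i\<in>A. c i *s w' i) = (\<Sum>i\<in>A. c i *s w i)"
    by (rule sum.cong) (use b in \<open>auto simp: w'_def\<close>)
  then have "c b *s x + (\<Sum>i\<in>A. c i *s w i) = 0"
    using c(2) b by (simp add: w'_def)
  then have "c b *s x = - (\<Sum>i\<in>A. c i *s w i)" by (simp add: eq_neg_iff_add_eq_0)
  also have "\<dots> = (\<Sum>i\<in>A. (- c i) *s w i)" by (simp add: vec_eq_iff sum_negf)
  finally have "c b *s x = (\<Sum>i\<in>A. (- c i) *s w i)" .
  then have "int (nat (c b)) *s x \<in> lattice" using c(1) by (simp add: sum_in_lattice)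
  then show ?thesis using that[of "nat (c b)"] c(1) by simp
qed

lemma torsion_imp_real_span:
  assumes "N > 0" "int N *s x \<in> lattice"
  obtains l where "real_vec x = (\<Sum>i\<in>A. l i *\<^sub>R real_vec (w i))"
proof -
  obtain c where c: "int N *s x = (\<Sum>i\<in>A. c i *s w i)" using assms(2) by (auto simp: lattice_def)
  have "real N *\<^sub>R real_vec x = (\<Sum>i\<in>A. of_int (c i) *\<^sub>R real_vec (w i))"
    using arg_cong[OF c, of real_vec] by (simp add: real_vec_smult real_vec_sum)
  then have "(1 / real N) *\<^sub>R real N *\<^sub>R real_vec x
      = (\<Sum>i\<in>A. (of_int (c i) / real N) *\<^sub>R real_vec (w i))"
    by (simp add: scaleR_sum_right)
  then show ?thesis using that assms(1) by simp
qed

section \<open>Tiling the half-open zonotope\<close>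

text \<open>The factors \<open>k i\<close> are absorbed into the ranges of the coefficients, so that
  boxes for different \<open>k\<close> share the same coordinates, and the points stay integer
  vectors.\<close>

definition box_points :: "(nat \<Rightarrow> nat) \<Rightarrow> (int ^ 'n) set" where
  "box_points k = {x. \<exists>l. real_vec x = (\<Sum>i\<in>A. l i *\<^sub>R real_vec (w i))
     \<and> (\<forall>i\<in>A. 0 \<le> l i \<and> l i < real (k i))}"

lemma zonotope_integer_points:
  assumes "\<And>i. i \<in> A \<Longrightarrow> k i > 0"
  shows "half_open_zonotope A (\<lambda>i. int (k i) *s w i) \<inter> integer_points = real_vec ` box_points k"
proof (intro equalityI subsetI)
  fix y assume "y \<in> half_open_zonotope A (\<lambda>i. int (k i) *s w i) \<inter> integer_points"
  then obtain l x where y: "y = real_vec x" "y = (\<Sum>i\<in>A. l i *\<^sub>R real_vec (int (k i) *s w i))"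
      and l: "\<forall>i\<in>A. 0 \<le> l i \<and> l i < 1"
    unfolding half_open_zonotope_def integer_points_def by blast
  have "real_vec x = (\<Sum>i\<in>A. (l i * real (k i)) *\<^sub>R real_vec (w i))"
    using y by (simp add: real_vec_smult)
  then have "x \<in> box_points k" unfolding box_points_def using l assms
    by (auto intro!: exI[of _ "\<lambda>i. l i * real (k i)"])
  then show "y \<in> real_vec ` box_points k" using y by blast
next
  fix y assume "y \<in> real_vec ` box_points k"
  then obtain x l where y: "y = real_vec x" "y = (\<Sum>i\<in>A. l i *\<^sub>R real_vec (w i))"
      and l: "\<forall>i\<in>A. 0 \<le> l i \<and> l i < real (k i)"
    unfolding box_points_def by blast
  have "y = (\<Sum>i\<in>A. (l i / real (k i)) *\<^sub>R real_vec (int (k i) *s w i))"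
    unfolding y(2) by (rule sum.cong) (use assms in \<open>auto simp: real_vec_smult\<close>)
  then have "y \<in> half_open_zonotope A (\<lambda>i. int (k i) *s w i)"
    using l assms
    by (auto simp: half_open_zonotope_def intro!: exI[of _ "\<lambda>i. l i / real (k i)"])
  then show "y \<in> half_open_zonotope A (\<lambda>i. int (k i) *s w i) \<inter> integer_points"
    using y(1) by (simp add: integer_points_def)
qed

text \<open>Each coefficient splits into its floor, one of 0, ..., \<open>k i - 1\<close>, and its
  fractional part. Removing the floors subtracts a lattice vector, so an integer point of the unit
  box remains.\<close>

lemma bij_betw_box_points:
  "bij_betw (\<lambda>(y, c). y + (\<Sum>i\<in>A. int (c i) *s w i))
     (box_points (\<lambda>_. 1) \<times> (\<Pi>\<^sub>E i\<in>A. {..<k i})) (box_points k)"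
proof (rule bij_betw_imageI)
  let ?f = "\<lambda>(y, c). y + (\<Sum>i\<in>A. int (c i) *s w i)"
  have expand: "real_vec (y + (\<Sum>i\<in>A. int (c i) *s w i)) = (\<Sum>i\<in>A. (l i + real (c i)) *\<^sub>R real_vec (w i))"
    if "real_vec y = (\<Sum>i\<in>A. l i *\<^sub>R real_vec (w i))" for y c l
    using that by (simp add: real_vec_add real_vec_sum real_vec_smult scaleR_left_distrib sum.distrib)
  show "inj_on ?f (box_points (\<lambda>_. 1) \<times> (\<Pi>\<^sub>E i\<in>A. {..<k i}))"
  proof (rule inj_onI, clarify)
    fix y c y' c'
    assume y: "y \<in> box_points (\<lambda>_. 1)" "y' \<in> box_points (\<lambda>_. 1)"
      and c: "c \<in> (\<Pi>\<^sub>E i\<in>A. {..<k i})" "c' \<in> (\<Pi>\<^sub>E i\<in>A. {..<k i})"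
      and eq: "y + (\<Sum>i\<in>A. int (c i) *s w i) = y' + (\<Sum>i\<in>A. int (c' i) *s w i)"
    obtain l l' where l: "real_vec y = (\<Sum>i\<in>A. l i *\<^sub>R real_vec (w i))" "\<forall>i\<in>A. 0 \<le> l i \<and> l i < 1"
      "real_vec y' = (\<Sum>i\<in>A. l' i *\<^sub>R real_vec (w i))" "\<forall>i\<in>A. 0 \<le> l' i \<and> l' i < 1"
      using y by (auto simp: box_points_def)
    have "c i = c' i" if "i \<in> A" for i
    proof -
      have "l i + real (c i) = l' i + real (c' i)"
        using real_coefficients_unique[OF _ that, of "\<lambda>i. l i + real (c i)" "\<lambda>i. l' i + real (c' i)"]
          expand[OF l(1), of c] expand[OF l(3), of c'] eq by simp
      \<comment> \<open>Both fractional parts lie in [0,1), so the natural numbers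
        \<open>c i\<close> and \<open>c' i\<close> differ by less than 1.\<close>
      then have "\<bar>real (c i) - real (c' i)\<bar> < 1" using l(2,4) that by force
      then show ?thesis by linarith
    qed
    then have "c = c'" using c by (intro PiE_ext)
    then show "y = y' \<and> c = c'" using eq by simp
  qed
  show "?f ` (box_points (\<lambda>_. 1) \<times> (\<Pi>\<^sub>E i\<in>A. {..<k i})) = box_points k"
  proof (intro equalityI subsetI)
    fix x assume "x \<in> ?f ` (box_points (\<lambda>_. 1) \<times> (\<Pi>\<^sub>E i\<in>A. {..<k i}))"
    then obtain y c l where x: "x = y + (\<Sum>i\<in>A. int (c i) *s w i)" and c: "c \<in> (\<Pi>\<^sub>E i\<in>A. {..<k i})"
      and l: "real_vec y = (\<Sum>i\<in>A. l i *\<^sub>R real_vec (w i))" "\<forall>i\<in>A. 0 \<le> l i \<and> l i < 1"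
      by (auto simp: box_points_def)
    have "0 \<le> l i + real (c i) \<and> l i + real (c i) < real (k i)" if "i \<in> A" for i
    proof -
      have "c i < k i" using c that by auto
      \<comment> \<open>Integrality sharpens \<open>c i < k i\<close> to leave room for a fractional
        part below 1.\<close>
      then have "real (c i) + 1 \<le> real (k i)" by linarith
      moreover have "0 \<le> l i" "l i < 1" using l(2) that by auto
      ultimately show ?thesis by linarith
    qed
    then show "x \<in> box_points k" using expand[OF l(1), of c] x unfolding box_points_def
      by (auto intro!: exI[of _ "\<lambda>i. l i + real (c i)"])
  next
    fix x assume "x \<in> box_points k"
    then obtain l where l: "real_vec x = (\<Sum>i\<in>A. l i *\<^sub>R real_vec (w i))"
        "\<And>i. i \<in> A \<Longrightarrow> 0 \<le> l i \<and> l i < real (k i)"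
      by (auto simp: box_points_def)
    \<comment> \<open>Nonnegativity of \<open>l i\<close> lets \<open>nat\<close> keep the floor
      intact; \<open>restrict\<close> makes \<open>c\<close> extensional, as membership in
      \<open>PiE\<close> demands.\<close>
    define c where "c = restrict (\<lambda>i. nat \<lfloor>l i\<rfloor>) A"
    have c: "real (c i) = of_int \<lfloor>l i\<rfloor>" "c i < k i" if "i \<in> A" for i
      using l(2)[OF that] that by (auto simp: c_def nat_less_iff floor_less_iff)
    define y where "y = x - (\<Sum>i\<in>A. int (c i) *s w i)"
    have x: "x = y + (\<Sum>i\<in>A. int (c i) *s w i)" by (simp add: y_def)
    have "real_vec y = real_vec x - (\<Sum>i\<in>A. real (c i) *\<^sub>R real_vec (w i))"
      using arg_cong[OF x, of real_vec] by (simp add: real_vec_add real_vec_sum real_vec_smult)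
    then have "real_vec y = (\<Sum>i\<in>A. (l i - real (c i)) *\<^sub>R real_vec (w i))"
      by (simp add: l(1) scaleR_left_diff_distrib sum_subtractf)
    moreover have "0 \<le> l i - real (c i) \<and> l i - real (c i) < 1" if "i \<in> A" for i
      unfolding c(1)[OF that] by linarith
    ultimately have "y \<in> box_points (\<lambda>_. 1)" unfolding box_points_def
      by (auto intro!: exI[of _ "\<lambda>i. l i - real (c i)"])
    moreover have "c \<in> (\<Pi>\<^sub>E i\<in>A. {..<k i})" using c(2) by (auto simp: c_def)
    ultimately show "x \<in> ?f ` (box_points (\<lambda>_. 1) \<times> (\<Pi>\<^sub>E i\<in>A. {..<k i}))"
      using x by (auto intro!: image_eqI[of _ _ "(y, c)"])
  qed
qed

lemma card_box_points: "card (box_points k) = card (box_points (\<lambda>_. 1)) * (\<Prod>i\<in>A. k i)"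
  using bij_betw_same_card[OF bij_betw_box_points[of k]]
  by (simp add: card_cartesian_product card_PiE)

section \<open>The lattice and the torsion of its quotient\<close>

lemma generate_eq_lattice: "generate int_vec_group (w ` A) = lattice"
proof (intro equalityI subsetI)
  interpret G: comm_group "int_vec_group :: (int ^ 'n) monoid" by (rule comm_group_int_vec_group)
  have inv: "inv\<^bsub>int_vec_group\<^esub> x = - x" for x :: "int ^ 'n"
    by (rule G.inv_equality) (auto simp: int_vec_group_def)
  {
    fix x assume "x \<in> generate int_vec_group (w ` A)"
    then show "x \<in> lattice"
    proof (induction rule: generate.induct)
      case one
      show ?case by (auto simp: lattice_def int_vec_group_def intro!: exI[of _ "\<lambda>_. 0"])
    next
      case (incl h)
      then obtain b where b: "b \<in> A" "h = w b" by blast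
      have "(\<Sum>i\<in>A. (if i = b then 1 else 0) *s w i) = (\<Sum>i\<in>A. if i = b then w i else 0)"
        by (rule sum.cong) auto
      then show ?case using b unfolding lattice_def
        by (auto intro!: exI[of _ "\<lambda>i. if i = b then 1 else 0"])
    next
      case (inv h)
      then obtain b where b: "b \<in> A" "h = w b" by blast
      have "(\<Sum>i\<in>A. (if i = b then -1 else 0) *s w i) = (\<Sum>i\<in>A. if i = b then - w i else 0)"
        by (rule sum.cong) (auto simp: vec_eq_iff)
      then show ?case using b unfolding lattice_def \<open>\<And>x. inv\<^bsub>int_vec_group\<^esub> x = - x\<close>
        by (auto intro!: exI[of _ "\<lambda>i. if i = b then -1 else 0"])
    next
      case (eng x y)
      then obtain c d where "x = (\<Sum>i\<in>A. c i *s w i)" "y = (\<Sum>i\<in>A. d i *s w i)"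
        by (auto simp: lattice_def)
      then have "x + y = (\<Sum>i\<in>A. (c i + d i) *s w i)"
        by (simp add: vector_sadd_rdistrib sum.distrib)
      then have "x + y \<in> lattice" by (simp only: sum_in_lattice)
      then show ?case by (simp add: int_vec_group_def)
    qed
  }
  let ?H = "generate int_vec_group (w ` A)"
  have zero: "0 \<in> ?H" using generate.one[of int_vec_group] by (simp add: int_vec_group_def)
  have add: "x + y \<in> ?H" if "x \<in> ?H" "y \<in> ?H" for x y
    using generate.eng[OF that] by (simp add: int_vec_group_def)
  \<comment> \<open>The converse inclusion is built up in stages: natural multiples by repeated
    addition, negative ones from the inverse of a generator, then sums.\<close>
  have nat: "int n *s x \<in> ?H" if "x \<in> ?H" for n x
    by (induction n) (auto simp: zero add vector_sadd_rdistrib that)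
  have int: "c *s w i \<in> ?H" if "i \<in> A" for c i
  proof (cases c)
    case (nonneg n)
    then show ?thesis using nat[of "w i" n] that by (auto intro: generate.incl)
  next
    case (neg n)
    have "- w i \<in> ?H" using generate.inv[of "w i" "w ` A" int_vec_group] that by (simp add: inv)
    then have "int (Suc n) *s (- w i) \<in> ?H" by (rule nat)
    also have "int (Suc n) *s (- w i) = c *s w i" by (simp add: neg vec_eq_iff)
    finally show ?thesis .
  qed
  \<comment> \<open>Stated for all subsets \<open>B\<close> so that induction over finite sets
    applies while the generators stay those of \<open>A\<close>.\<close>
  have sum: "(\<Sum>i\<in>B. c i *s w i) \<in> ?H" if "B \<subseteq> A" for B c
    using finite_subset[OF that finite_A] that
    by (induction B rule: finite_induct) (auto simp: zero add int)
  fix x assume "x \<in> lattice"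
  then show "x \<in> ?H" using sum by (auto simp: lattice_def)
qed

text \<open>Every torsion coset meets the unit box in exactly one point. Subtracting the floors of
  the coefficients of a representative gives such a point; two points of one coset have coefficients
  differing by integers of absolute value below 1, hence by 0.\<close>

lemma card_torsion: "card (torsion (int_vec_group Mod lattice)) = card (box_points (\<lambda>_. 1))"
proof -
  interpret G: comm_group "int_vec_group :: (int ^ 'n) monoid" by (rule comm_group_int_vec_group)
  have sub: "subgroup lattice int_vec_group"
    unfolding generate_eq_lattice[symmetric]
    by (rule G.generate_is_subgroup) (auto simp: int_vec_group_def)
  interpret N: normal lattice int_vec_group by (rule G.subgroup_imp_normal[OF sub])
  have coset: "lattice #>\<^bsub>int_vec_group\<^esub> x = {h + x | h. h \<in> lattice}" for x
    by (auto simp: r_coset_def int_vec_group_def)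
  have zero: "0 \<in> lattice" using N.one_closed by (simp add: int_vec_group_def)
  have self: "x \<in> lattice #>\<^bsub>int_vec_group\<^esub> x" for x
    unfolding coset using zero by force
  have coset_eq: "lattice #>\<^bsub>int_vec_group\<^esub> y = lattice #>\<^bsub>int_vec_group\<^esub> x"
    if "y \<in> lattice #>\<^bsub>int_vec_group\<^esub> x" for x y
    using G.repr_independence[OF that _ sub] by (simp add: int_vec_group_def)
  have pow: "x [^]\<^bsub>int_vec_group\<^esub> n = int n *s x" for x :: "int ^ 'n" and n :: nat
    by (induction n) (auto simp: int_vec_group_def vector_sadd_rdistrib add.commute)
  have coset_one: "lattice #>\<^bsub>int_vec_group\<^esub> x = lattice \<longleftrightarrow> x \<in> lattice" for x
    using self[of x] coset_eq[of x 0] by (auto simp: coset)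
  have carrier: "carrier (int_vec_group :: (int ^ 'n) monoid) = UNIV" by (simp add: int_vec_group_def)
  \<comment> \<open>A coset has finite order exactly when a positive multiple of its representative
    lies in the lattice, the condition that the two lemmas on the real span handle.\<close>
  have torsion: "torsion (int_vec_group Mod lattice)
      = {lattice #>\<^bsub>int_vec_group\<^esub> x | x. \<exists>n>0. int n *s x \<in> lattice}"
  proof -
    have "(\<exists>n::nat. n > 0 \<and> (lattice #>\<^bsub>int_vec_group\<^esub> x) [^]\<^bsub>int_vec_group Mod lattice\<^esub> n
        = \<one>\<^bsub>int_vec_group Mod lattice\<^esub>) \<longleftrightarrow> (\<exists>n>0. int n *s x \<in> lattice)" for x
      by (simp add: N.FactGroup_pow pow coset_one carrier)
    then show ?thesis unfolding torsion_def carrier_FactGroup carrier by blast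
  qed
  have "bij_betw (\<lambda>x. lattice #>\<^bsub>int_vec_group\<^esub> x) (box_points (\<lambda>_. 1))
      (torsion (int_vec_group Mod lattice))"
  proof (rule bij_betw_imageI)
    show "inj_on (\<lambda>x. lattice #>\<^bsub>int_vec_group\<^esub> x) (box_points (\<lambda>_. 1))"
    proof (rule inj_onI)
      fix x y assume xy: "x \<in> box_points (\<lambda>_. 1)" "y \<in> box_points (\<lambda>_. 1)"
        and "lattice #>\<^bsub>int_vec_group\<^esub> x = lattice #>\<^bsub>int_vec_group\<^esub> y"
      then have "x \<in> lattice #>\<^bsub>int_vec_group\<^esub> y" using self by blast
      then obtain c where c: "x = (\<Sum>i\<in>A. c i *s w i) + y" unfolding coset by (auto simp: lattice_def)
      obtain l l' where l: "real_vec x = (\<Sum>i\<in>A. l i *\<^sub>R real_vec (w i))" "\<forall>i\<in>A. 0 \<le> l i \<and> l i < 1"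
        "real_vec y = (\<Sum>i\<in>A. l' i *\<^sub>R real_vec (w i))" "\<forall>i\<in>A. 0 \<le> l' i \<and> l' i < 1"
        using xy by (auto simp: box_points_def)
      have "(\<Sum>i\<in>A. l i *\<^sub>R real_vec (w i)) = (\<Sum>i\<in>A. (of_int (c i) + l' i) *\<^sub>R real_vec (w i))"
        using arg_cong[OF c, of real_vec] l(1,3)
        by (simp add: real_vec_add real_vec_sum real_vec_smult scaleR_left_distrib sum.distrib)
      then have "l i = of_int (c i) + l' i" if "i \<in> A" for i
        using real_coefficients_unique[OF _ that, of l "\<lambda>i. of_int (c i) + l' i"] by simp
      then have "\<bar>real_of_int (c i)\<bar> < 1" if "i \<in> A" for i using that l(2,4) by force
      then have "c i = 0" if "i \<in> A" for i using that by force
      then show "x = y" using c by simp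
    qed
    show "(\<lambda>x. lattice #>\<^bsub>int_vec_group\<^esub> x) ` box_points (\<lambda>_. 1) = torsion (int_vec_group Mod lattice)"
    proof (intro equalityI subsetI)
      fix X assume "X \<in> (\<lambda>x. lattice #>\<^bsub>int_vec_group\<^esub> x) ` box_points (\<lambda>_. 1)"
      then obtain x l where X: "X = lattice #>\<^bsub>int_vec_group\<^esub> x"
          and "real_vec x = (\<Sum>i\<in>A. l i *\<^sub>R real_vec (w i))"
        by (auto simp: box_points_def)
      then obtain n :: nat where "n > 0" "int n *s x \<in> lattice"
        using real_span_imp_torsion by metis
      then show "X \<in> torsion (int_vec_group Mod lattice)" unfolding torsion X by blast
    next
      fix X assume "X \<in> torsion (int_vec_group Mod lattice)"
      then obtain x n where X: "X = lattice #>\<^bsub>int_vec_group\<^esub> x" and "n > 0" "int n *s x \<in> lattice"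
        unfolding torsion by auto
      then obtain l where l: "real_vec x = (\<Sum>i\<in>A. l i *\<^sub>R real_vec (w i))"
        using torsion_imp_real_span by metis
      \<comment> \<open>Translating by the negated floors stays in the coset of \<open>x\<close> and
        turns the coefficients into \<open>frac (l i)\<close>.\<close>
      define y where "y = (\<Sum>i\<in>A. (- \<lfloor>l i\<rfloor>) *s w i) + x"
      have "real_vec y = (\<Sum>i\<in>A. frac (l i) *\<^sub>R real_vec (w i))"
        by (simp only: y_def real_vec_add real_vec_sum real_vec_smult l frac_def)
          (simp add: scaleR_left_diff_distrib sum_subtractf sum_negf)
      then have "y \<in> box_points (\<lambda>_. 1)" unfolding box_points_def
        by (auto intro!: exI[of _ "\<lambda>i. frac (l i)"] simp: frac_lt_1)
      moreover have "y \<in> lattice #>\<^bsub>int_vec_group\<^esub> x"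
        unfolding coset y_def using sum_in_lattice[of "\<lambda>i. - \<lfloor>l i\<rfloor>"] by blast
      ultimately show "X \<in> (\<lambda>x. lattice #>\<^bsub>int_vec_group\<^esub> x) ` box_points (\<lambda>_. 1)"
        using coset_eq X by blast
    qed
  qed
  then show ?thesis using bij_betw_same_card by force
qed

end

section \<open>Counting for sublists and averaging over the random sublist\<close>

lemma card_zonotope_integer_points:
  assumes "lin_independent_list E" "A \<subseteq> {..<length E}" "\<And>i. i < length E \<Longrightarrow> 0 < k i"
  shows "card (half_open_zonotope A (\<lambda>i. int (k i) *s E ! i) \<inter> integer_points)
    = sublist_mult E A * (\<Prod>i\<in>A. k i)"
proof -
  interpret int_independent_family A "(!) E"
    using assms(2) lin_independent_list_relation[OF assms(1,2)]
    by unfold_locales (auto intro: finite_subset)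
  have "card (half_open_zonotope A (\<lambda>i. int (k i) *s E ! i) \<inter> integer_points) = card (box_points k)"
    using assms(2,3) by (subst zonotope_integer_points) (auto intro!: card_image inj_onI)
  also have "\<dots> = sublist_mult E A * (\<Prod>i\<in>A. k i)"
    by (simp add: card_box_points[of k] card_torsion sublist_mult_def sublist_span_def generate_eq_lattice)
  finally show ?thesis .
qed

text \<open>\<open>Collect\<close> is injective, so the probability of \<open>A\<close> is that of
  its indicator function under the product distribution.\<close>

lemma pmf_random_sublist:
  assumes "\<And>i. i < length E \<Longrightarrow> 0 \<le> p i \<and> p i \<le> 1" "A \<subseteq> {..<length E}"
  shows "pmf (random_sublist E p) A = (\<Prod>i\<in>A. p i) * (\<Prod>i\<in>{..<length E} - A. 1 - p i)"
proof -
  have "pmf (random_sublist E p) A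
      = pmf (Pi_pmf {..<length E} False (\<lambda>i. bernoulli_pmf (p i))) (\<lambda>i. i \<in> A)"
    unfolding random_sublist_def
    using pmf_map_inj'[of Collect "Pi_pmf {..<length E} False (\<lambda>i. bernoulli_pmf (p i))" "\<lambda>i. i \<in> A"]
    by (simp add: inj_def Collect_inj)
  also have "\<dots> = (\<Prod>i<length E. if i \<in> A then p i else 1 - p i)"
    \<comment> \<open>The indicator of \<open>A\<close> takes the default value \<open>False\<close>
      outside the index range because \<open>A\<close> lies inside it.\<close>
    using assms by (subst pmf_Pi') (auto intro!: prod.cong)
  also have "\<dots> = (\<Prod>i\<in>A. p i) * (\<Prod>i\<in>{..<length E} - A. 1 - p i)"
    using assms(2) by (subst prod.If_cases) (auto simp: Int_absorb1 Diff_eq)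
  finally show ?thesis .
qed

lemma expectation_random_sublist:
  assumes "\<And>i. i < length E \<Longrightarrow> 0 \<le> p i \<and> p i \<le> 1"
  shows "measure_pmf.expectation (random_sublist E p) f
    = (\<Sum>A\<in>Pow {..<length E}. f A * ((\<Prod>i\<in>A. p i) * (\<Prod>i\<in>{..<length E} - A. 1 - p i)))"
proof -
  have "set_pmf (random_sublist E p) \<subseteq> Pow {..<length E}"
    using set_Pi_pmf_subset[of "{..<length E}" False "\<lambda>i. bernoulli_pmf (p i)"]
    by (auto simp: random_sublist_def)
  then have "measure_pmf.expectation (random_sublist E p) f
      = (\<Sum>A\<in>Pow {..<length E}. f A * pmf (random_sublist E p) A)"
    by (intro integral_measure_pmf_real) auto
  then show ?thesis by (simp add: pmf_random_sublist assms)
qed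

text \<open>The first conjunct takes the right-hand side as a polynomial and so covers
  \<open>p i = 1\<close>; the second is the literal form with quotients, for all
  \<open>p i < 1\<close>.\<close>

theorem theorem3p7:
  fixes E :: "(int ^ 'n) list" and k :: "nat \<Rightarrow> nat" and p :: "nat \<Rightarrow> real"
  assumes "lin_independent_list E"
    and "\<And>i. i < length E \<Longrightarrow> 0 < k i"
    and "\<And>i. i < length E \<Longrightarrow> 0 \<le> p i \<and> p i \<le> 1"
  shows "(measure_pmf.expectation (random_sublist E p)
      (\<lambda>A. real (card (half_open_zonotope A (\<lambda>i. int (k i) *s E ! i) \<inter> integer_points)))
    = (\<Sum>A\<in>Pow {..<length E}. real (sublist_mult E A) * (\<Prod>i\<in>A. real (k i) * p i)
        * (\<Prod>i\<in>{..<length E} - A. 1 - p i)))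
    \<and> ((\<forall>i<length E. p i < 1) \<longrightarrow>
      measure_pmf.expectation (random_sublist E p)
      (\<lambda>A. real (card (half_open_zonotope A (\<lambda>i. int (k i) *s E ! i) \<inter> integer_points)))
    = (\<Prod>i<length E. 1 - p i)
        * multivariate_tutte (arith_matroid E) 1 (\<lambda>i. real (k i) * p i / (1 - p i)))"
proof -
  let ?X = "measure_pmf.expectation (random_sublist E p)
      (\<lambda>A. real (card (half_open_zonotope A (\<lambda>i. int (k i) *s E ! i) \<inter> integer_points)))"
  let ?S = "\<Sum>A\<in>Pow {..<length E}. real (sublist_mult E A) * (\<Prod>i\<in>A. real (k i) * p i)
        * (\<Prod>i\<in>{..<length E} - A. 1 - p i)"
  have X: "?X = ?S"
    by (subst expectation_random_sublist)
      (auto simp: assms(3) card_zonotope_integer_points[OF assms(1) _ assms(2)] prod.distrib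
        intro!: sum.cong)
  moreover have "?S = (\<Prod>i<length E. 1 - p i)
        * multivariate_tutte (arith_matroid E) 1 (\<lambda>i. real (k i) * p i / (1 - p i))"
    if p: "\<forall>i<length E. p i < 1"
    unfolding multivariate_tutte_def arith_matroid_def prod.case sum_distrib_left
  proof (rule sum.cong)
    fix A assume "A \<in> Pow {..<length E}"
    then have A: "A \<subseteq> {..<length E}" by simp
    have "(\<Prod>i\<in>A. 1 - p i) \<noteq> 0" using p A by (force simp: finite_subset[OF A])
    \<comment> \<open>The factors over \<open>A\<close> cancel the denominators of the weights and
      those over the complement remain; at \<open>q = 1\<close> the rank factor is 1.\<close>
    moreover have "(\<Prod>i<length E. 1 - p i) = (\<Prod>i\<in>{..<length E} - A. 1 - p i) * (\<Prod>i\<in>A. 1 - p i)"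
      using prod.subset_diff[OF A] by simp
    ultimately show "real (sublist_mult E A) * (\<Prod>i\<in>A. real (k i) * p i)
        * (\<Prod>i\<in>{..<length E} - A. 1 - p i)
      = (\<Prod>i<length E. 1 - p i) * (real (sublist_mult E A) * 1 powi (- int (sublist_rank E A))
        * (\<Prod>i\<in>A. real (k i) * p i / (1 - p i)))"
      by (simp add: prod_dividef)
  qed simp
  ultimately show ?thesis by simp
qed

end
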